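(* Let $\delta := 2\epsilon + \frac{2-\omega}{\omega}\min(\mathrm{diag}(\mathbf{D}))$ and let $\omega\in(0,2)$, $\epsilon\in[0,\infty)$ be chosen such that $\delta\in(0,\infty)$. Assume $q$ is strongly convex, i.e. $\mathbf{A}\succeq\sigma\mathbf{I}$ with $\sigma>0$. Let $\mathbf{x}^{k+1}=\mathcal{T}(\mathbf{x}^k)$, $k\ge0$, assume $\|\mathbf{x}^k\|\le R$ for all $k$, and let $\mathbf{x}^*$ be the minimizer of $f$. With $C_5:=\|\mathbf{C}\|^2/(\delta\sigma)$, for all $k\ge0$: $$f(\mathbf{x}^k)-f(\mathbf{x}^* )\le\left(\tfrac{C_5}{1+C_5}\right)^k[f(\mathbf{x}^0)-f(\mathbf{x}^* )],$$ $$\|\mathbf{x}^{k+1}-\mathbf{x}^*\|_2^2\le\frac{8\|\mathbf{C}\|^2}{\sigma^2\delta}\left(\tfrac{C_5}{1+C_5}\right)^k[f(\mathbf{x}^0)-f(\mathbf{x}^* )].$$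
   Context: Let $\mathbf{A}\in\mathbb{R}^{n\times n}$ be symmetric positive semidefinite, $\mathbf{b}\in\mathbb{R}^n$, $q(\mathbf{x})=\frac12\mathbf{x}^T\mathbf{A}\mathbf{x}+\mathbf{x}^T\mathbf{b}$, and let $h:\mathbb{R}^n\to\mathbb{R}$ be convex and separable, $h(\mathbf{x})=\sum_{i=1}^n h_i(\mathbf{x}_i)$. Put $f=q+h$, assumed bounded below. $\partial h$ is the convex subdifferential. $\|\cdot\|$ is the Euclidean norm for vectors and the spectral norm for matrices. Let $\mathbf{D}$ be the diagonal part of $\mathbf{A}$ and $\mathbf{L}$ its strictly lower triangular part, so $\mathbf{A}=\mathbf{L}+\mathbf{D}+\mathbf{L}^T$; $\mathrm{diag}(\mathbf{D})$ is the vector of diagonal entries and $\min(\cdot)$ its smallest entry. Given $\omega\in(0,2)$ and $\epsilon\in[0,\infty)$ with all diagonal entries of $\mathbf{B}$ positive, set $\mathbf{B}=\mathbf{L}+\frac1\omega\mathbf{D}+\epsilon\mathbf{I}$ and $\mathbf{C}=\mathbf{L}^T+\frac{\omega-1}{\omega}\mathbf{D}-\epsilon\mathbf{I}$, so $\mathbf{A}=\mathbf{B}+\mathbf{C}$. $\mathcal{T}(\mathbf{x})$ is the unique $\mathbf{z}$ with $\mathbf{0}\in\mathbf{B}\mathbf{z}+\mathbf{C}\mathbf{x}+\mathbf{b}+\partial h(\mathbf{z})$. *)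

theory Defs
  imports "HOL-Analysis.Analysis"
begin

(* A square matrix of size n is an element of real ^ 'n ^ 'n, where the index type 'n is finite and
   linearly ordered.  The order, which the notion of triangular part needs, makes 'n an
   order-isomorphic copy of {1, ..., n}. *)

definition pos_semidef :: "real ^ 'n ^ 'n \<Rightarrow> bool" where
  "pos_semidef M \<longleftrightarrow> transpose M = M \<and> (\<forall>v. 0 \<le> v \<bullet> (M *v v))"

definition loewner_le :: "real ^ 'n ^ 'n \<Rightarrow> real ^ 'n ^ 'n \<Rightarrow> bool" where
  "loewner_le M N \<longleftrightarrow> pos_semidef (N - M)"

(* The type-class norm on real ^ 'n ^ 'n is the Frobenius norm, so the spectral norm is taken as the
   operator norm with respect to the Euclidean norm. *)
definition spectral_norm :: "real ^ 'n ^ 'n \<Rightarrow> real" where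
  "spectral_norm M = onorm (\<lambda>v. M *v v)"

definition diag_part :: "real ^ 'n ^ 'n \<Rightarrow> real ^ 'n ^ 'n" where
  "diag_part A = (\<chi> i j. if i = j then A $ i $ j else 0)"

definition strict_lower_part ::
  "real ^ 'n::{finite,linorder} ^ 'n::{finite,linorder}
     \<Rightarrow> real ^ 'n::{finite,linorder} ^ 'n::{finite,linorder}" where
  "strict_lower_part A = (\<chi> i j. if j < i then A $ i $ j else 0)"

definition diag_vec :: "real ^ 'n ^ 'n \<Rightarrow> real ^ 'n" where
  "diag_vec M = (\<chi> i. M $ i $ i)"

definition min_entry :: "real ^ 'n \<Rightarrow> real" where
  "min_entry v = Min (range (\<lambda>i. v $ i))"

definition split_B ::
  "real \<Rightarrow> real
     \<Rightarrow> real ^ 'n::{finite,linorder} ^ 'n::{finite,linorder}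
     \<Rightarrow> real ^ 'n::{finite,linorder} ^ 'n::{finite,linorder}" where
  "split_B \<omega> \<epsilon> A = strict_lower_part A + (1 / \<omega>) *\<^sub>R diag_part A + \<epsilon> *\<^sub>R mat 1"

definition split_C ::
  "real \<Rightarrow> real
     \<Rightarrow> real ^ 'n::{finite,linorder} ^ 'n::{finite,linorder}
     \<Rightarrow> real ^ 'n::{finite,linorder} ^ 'n::{finite,linorder}" where
  "split_C \<omega> \<epsilon> A =
     transpose (strict_lower_part A) + ((\<omega> - 1) / \<omega>) *\<^sub>R diag_part A - \<epsilon> *\<^sub>R mat 1"

lemma split_B_plus_split_C:
  fixes A :: "real ^ 'n::{finite,linorder} ^ 'n::{finite,linorder}"
  assumes "transpose A = A" and "\<omega> \<noteq> 0"
  shows "split_B \<omega> \<epsilon> A + split_C \<omega> \<epsilon> A = A"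
proof -
  have sym: "A $ j $ i = A $ i $ j" for i j
    using assms(1) by (metis transpose_def vec_lambda_beta)
  have "(split_B \<omega> \<epsilon> A + split_C \<omega> \<epsilon> A) $ i $ j = A $ i $ j" for i j
    using assms(2) sym[of i j]
    by (cases i j rule: linorder_cases)
       (auto simp: split_B_def split_C_def strict_lower_part_def diag_part_def mat_def
          transpose_def field_simps)
  then show ?thesis
    by (simp add: vec_eq_iff)
qed

definition quad_fun ::
  "real ^ 'n ^ 'n
     \<Rightarrow> real ^ 'n
     \<Rightarrow> real ^ 'n \<Rightarrow> real" where
  "quad_fun A b x = 1/2 * (x \<bullet> (A *v x)) + x \<bullet> b"

definition subdifferential ::
  "('a::real_inner \<Rightarrow> real) \<Rightarrow> 'a \<Rightarrow> 'a set" where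
  "subdifferential h x = {g. \<forall>y. h x + g \<bullet> (y - x) \<le> h y}"

(* The set under the membership sign is B z + C x + b + subdifferential h z. *)
definition splitting_op ::
  "real \<Rightarrow> real
     \<Rightarrow> real ^ 'n::{finite,linorder} ^ 'n::{finite,linorder}
     \<Rightarrow> real ^ 'n::{finite,linorder}
     \<Rightarrow> (real ^ 'n::{finite,linorder} \<Rightarrow> real)
     \<Rightarrow> real ^ 'n::{finite,linorder} \<Rightarrow> real ^ 'n::{finite,linorder}" where
  "splitting_op \<omega> \<epsilon> A b h x =
     (THE z. 0 \<in> (\<lambda>g. split_B \<omega> \<epsilon> A *v z + split_C \<omega> \<epsilon> A *v x + b + g) ` subdifferential h z)"

end

theory Submission
  imports Defs
begin

text \<open>
  One step \<open>z = T(x)\<close> of the splitting comes with a subgradient \<open>g\<close> of \<open>h\<close> at \<open>z\<close> such that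
  \<open>A z + b + g = C (z - x)\<close>: the vector \<open>C (z - x)\<close> is a subgradient of \<open>f\<close> at \<open>z\<close>, and it is small
  when the step is short. This is used twice.

  Comparing \<open>z\<close> with \<open>x\<close>, the exact second-order expansion of \<open>q\<close> leaves the quadratic form
  \<open>1/2 A - C = 1/2 (B - C)\<close> in \<open>x - z\<close>. The skew part \<open>L - L\<^sup>T\<close> does not contribute to this form,
  and the remaining diagonal is at least \<open>\<delta>/2\<close>, so the step decreases \<open>f\<close> by at least
  \<open>\<delta>/2 \<parallel>x - z\<parallel>\<^sup>2\<close> (\<open>splitting_step_decrease\<close>).

  Comparing \<open>z\<close> with the minimizer, strong convexity of \<open>q\<close> gives, for every \<open>y\<close>,
  \<open>f(z) - f(y) \<le> \<parallel>C\<parallel> d e - \<sigma>/2 e\<^sup>2\<close> with \<open>d = \<parallel>x - z\<parallel>\<close> and \<open>e = \<parallel>z - y\<parallel>\<close>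
  (\<open>splitting_step_gap\<close>). Maximizing over \<open>e\<close> bounds the gap \<open>f(z) - f(x\<^sup>*)\<close> by
  \<open>\<parallel>C\<parallel>\<^sup>2 d\<^sup>2 / (2 \<sigma>)\<close>, which by the decrease is at most \<open>C\<^sub>5 (f(x) - f(z))\<close>; this rearranges to
  the contraction of the gap by \<open>C\<^sub>5 / (1 + C\<^sub>5)\<close>. Nonnegativity of the gap forces
  \<open>e \<le> 2 \<parallel>C\<parallel> d / \<sigma>\<close>, which yields the bound on the distance.

  It remains to see that the inclusion defining \<open>T\<close> has exactly one solution. Since \<open>B\<close> is lower
  triangular and \<open>h\<close> is separable, a solution is found by forward substitution: each coordinate
  satisfies a scalar inclusion, which is the optimality condition of a strongly convex function of
  one real variable (\<open>ex_scalar_inclusion\<close>). It is unique because the form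
  \<open>v \<bullet> B v\<close>, the mean of the forms of \<open>A\<close> and \<open>B - C\<close>, is positive for \<open>v \<noteq> 0\<close>, while the
  subdifferential is monotone (\<open>splitting_op_inclusion\<close>).
\<close>

section \<open>The scalar inclusion\<close>

text \<open>
  The affine minorant of \<open>\<phi>\<close> at \<open>0\<close> makes \<open>a/2 t\<^sup>2 + c t + \<phi> t\<close> exceed its value at \<open>0\<close> outside
  a bounded interval, so continuity provides a global minimizer.
\<close>

lemma ex_minimizer_quadratic_plus_convex:
  fixes \<phi> :: "real \<Rightarrow> real"
  assumes conv: "convex_on UNIV \<phi>" and a: "0 < a"
  shows "\<exists>t. \<forall>y. a/2 * t\<^sup>2 + c * t + \<phi> t \<le> a/2 * y\<^sup>2 + c * y + \<phi> y"
proof -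
  define \<psi> where "\<psi> y = a/2 * y\<^sup>2 + c * y + \<phi> y" for y
  obtain s where minorant: "\<And>y. \<phi> 0 + s * y \<le> \<phi> y"
    using convex_le_Inf_differential[OF conv, of 0]
    by (auto intro: that)
  \<comment> \<open>Beyond the radius \<open>r\<close> the quadratic term dominates the slope \<open>s + c\<close> of the minorant.\<close>
  define r where "r = 2 * \<bar>s + c\<bar> / a"
  have r0: "0 \<le> r" using a by (simp add: r_def)
  have outside: "\<psi> 0 \<le> \<psi> y" if "r \<le> \<bar>y\<bar>" for y
  proof -
    have "\<bar>s + c\<bar> \<le> a/2 * \<bar>y\<bar>" using that a by (simp add: r_def field_simps)
    then have "\<bar>s + c\<bar> * \<bar>y\<bar> \<le> a/2 * \<bar>y\<bar> * \<bar>y\<bar>" by (intro mult_right_mono) auto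
    moreover have "- ((s + c) * y) \<le> \<bar>s + c\<bar> * \<bar>y\<bar>"
      by (metis abs_ge_minus_self abs_mult)
    ultimately have "0 \<le> a/2 * y\<^sup>2 + (s + c) * y"
      by (simp add: power2_eq_square mult.assoc)
    then show ?thesis using minorant[of y] by (simp add: \<psi>_def algebra_simps)
  qed
  have "continuous_on UNIV \<phi>"
    using conv by (intro convex_on_continuous) auto
  then have "continuous_on {-r..r} \<psi>"
    unfolding \<psi>_def by (intro continuous_intros) (auto intro: continuous_on_subset)
  then have "\<exists>t\<in>{-r..r}. \<forall>y\<in>{-r..r}. \<psi> t \<le> \<psi> y"
    using r0 by (intro continuous_attains_inf) auto
  then obtain t where t: "\<And>y. y \<in> {-r..r} \<Longrightarrow> \<psi> t \<le> \<psi> y"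
    by blast
  have "\<psi> t \<le> \<psi> y" for y
  proof (cases "y \<in> {-r..r}")
    case False
    then show ?thesis using outside[of y] t[of 0] r0 by (auto simp: abs_if)
  qed (rule t)
  then show ?thesis unfolding \<psi>_def by blast
qed

lemma ex_scalar_inclusion:
  fixes \<phi> :: "real \<Rightarrow> real"
  assumes conv: "convex_on UNIV \<phi>" and a: "0 < a"
  shows "\<exists>t. - (a * t + c) \<in> subdifferential \<phi> t"
proof -
  obtain t where min: "\<And>y. a/2 * t\<^sup>2 + c * t + \<phi> t \<le> a/2 * y\<^sup>2 + c * y + \<phi> y"
    using ex_minimizer_quadratic_plus_convex[OF assms] by blast
  have "\<phi> t - (a * t + c) * (y - t) \<le> \<phi> y" for y
  proof -
    \<comment> \<open>Minimality along the segment from \<open>t\<close> to \<open>y\<close>, divided by its parameter \<open>s\<close>; then \<open>s\<close> tends to \<open>0\<close>.\<close>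
    have along: "\<phi> t - (a * t + c) * (y - t) - s * (a/2 * (y - t)\<^sup>2) \<le> \<phi> y" if "0 < s" "s < 1" for s
    proof -
      have "\<phi> ((1 - s) * t + s * y) \<le> (1 - s) * \<phi> t + s * \<phi> y"
        using convex_onD[OF conv, of s t y] that by simp
      with min[of "(1 - s) * t + s * y"]
      have "0 \<le> s * (\<phi> y - \<phi> t + (a * t + c) * (y - t) + s * (a/2 * (y - t)\<^sup>2))"
        by (simp add: algebra_simps power2_eq_square)
      then show ?thesis using that by (simp add: zero_le_mult_iff)
    qed
    have "((\<lambda>s. \<phi> t - (a * t + c) * (y - t) - s * (a/2 * (y - t)\<^sup>2))
        \<longlongrightarrow> \<phi> t - (a * t + c) * (y - t) - 0 * (a/2 * (y - t)\<^sup>2)) (at_right 0)"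
      by (intro tendsto_intros)
    moreover have "\<forall>\<^sub>F s in at_right 0.
        \<phi> t - (a * t + c) * (y - t) - s * (a/2 * (y - t)\<^sup>2) \<le> \<phi> y"
      using along by (intro eventually_at_rightI[of 0 1]) auto
    ultimately show ?thesis by (auto dest: tendsto_upperbound)
  qed
  then show ?thesis by (auto simp: subdifferential_def algebra_simps intro!: exI[of _ t])
qed

section \<open>Separable convex functions\<close>

lemma convex_summand_of_separable:
  fixes h :: "real ^ 'n \<Rightarrow> real"
  assumes conv: "convex_on UNIV h" and sep: "\<And>v. h v = (\<Sum>i\<in>UNIV. hc i (v $ i))"
  shows "convex_on UNIV (hc i)"
proof (rule convex_onI)
  fix t u v :: real
  assume t: "0 < t" "t < 1"
  \<comment> \<open>On the line through the origin in direction \<open>i\<close>, \<open>h\<close> is \<open>hc i\<close> up to a constant.\<close>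
  define K where "K = (\<Sum>j\<in>UNIV - {i}. hc j 0)"
  have line: "h (axis i w) = hc i w + K" for w
    by (simp add: sep K_def sum.remove[of UNIV i] axis_def)
  have "(1 - t) *\<^sub>R axis i u + t *\<^sub>R axis i v = axis i ((1 - t) * u + t * v)"
    by (simp add: vec_eq_iff axis_def)
  then have "hc i ((1 - t) * u + t * v) + K \<le> (1 - t) * (hc i u + K) + t * (hc i v + K)"
    using convex_onD[OF conv, of t "axis i u" "axis i v"] t by (simp add: line)
  then show "hc i ((1 - t) *\<^sub>R u + t *\<^sub>R v) \<le> (1 - t) * hc i u + t * hc i v"
    by (simp add: algebra_simps)
qed simp

lemma subdifferential_separableI:
  fixes h :: "real ^ 'n \<Rightarrow> real"
  assumes sep: "\<And>v. h v = (\<Sum>i\<in>UNIV. hc i (v $ i))"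
    and g: "\<And>i. g $ i \<in> subdifferential (hc i) (z $ i)"
  shows "g \<in> subdifferential h z"
proof -
  have "h z + g \<bullet> (y - z) \<le> h y" for y
  proof -
    have "h z + g \<bullet> (y - z) = (\<Sum>i\<in>UNIV. hc i (z $ i) + g $ i * (y $ i - z $ i))"
      by (simp add: sep inner_vec_def sum.distrib)
    also have "\<dots> \<le> h y"
      unfolding sep using g by (intro sum_mono) (auto simp: subdifferential_def)
    finally show ?thesis .
  qed
  then show ?thesis by (simp add: subdifferential_def)
qed

lemma subdifferential_monotone:
  assumes "g \<in> subdifferential h z" and "g' \<in> subdifferential h z'"
  shows "0 \<le> (g - g') \<bullet> (z - z')"
proof -
  have "h z + g \<bullet> (z' - z) \<le> h z'" "h z' + g' \<bullet> (z - z') \<le> h z"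
    using assms by (auto simp: subdifferential_def)
  then show ?thesis by (simp add: inner_diff_left inner_diff_right)
qed

section \<open>Quadratic forms of the splitting\<close>

lemma inner_transpose_mult:
  fixes M :: "real ^ 'n ^ 'n"
  shows "u \<bullet> (transpose M *v v) = (M *v u) \<bullet> v"
  by (simp add: dot_lmul_matrix flip: vector_transpose_matrix)

lemma inner_diag_part_ge:
  fixes A :: "real ^ 'n ^ 'n"
  shows "min_entry (diag_vec (diag_part A)) * (norm v)\<^sup>2 \<le> v \<bullet> (diag_part A *v v)"
proof -
  have "min_entry (diag_vec (diag_part A)) * (norm v)\<^sup>2
      = (\<Sum>i\<in>UNIV. min_entry (diag_vec (diag_part A)) * (v $ i)\<^sup>2)"
    unfolding power2_norm_eq_inner by (simp add: inner_vec_def sum_distrib_left power2_eq_square)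
  also have "\<dots> \<le> (\<Sum>i\<in>UNIV. A $ i $ i * (v $ i)\<^sup>2)"
    by (intro sum_mono mult_right_mono)
       (auto simp: min_entry_def diag_vec_def diag_part_def intro!: Min_le)
  also have "\<dots> = v \<bullet> (diag_part A *v v)"
    by (simp add: inner_vec_def matrix_vector_mult_def diag_part_def power2_eq_square
        if_distrib[of "\<lambda>c. c * _"] cong: if_cong)
       (simp add: algebra_simps)
  finally show ?thesis .
qed

text \<open>
  \<open>B - C = (L - L\<^sup>T) + (2 - \<omega>)/\<omega> D + 2 \<epsilon> I\<close>, and the skew part \<open>L - L\<^sup>T\<close> has zero quadratic form.
\<close>

lemma split_quadratic_forms_gap:
  fixes A :: "real ^ 'n::{finite,linorder} ^ 'n::{finite,linorder}"
  assumes omega: "0 < \<omega>" "\<omega> < 2"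
    and delta: "\<delta> = 2 * \<epsilon> + (2 - \<omega>) / \<omega> * min_entry (diag_vec (diag_part A))"
  shows "\<delta> * (norm v)\<^sup>2 \<le> v \<bullet> (split_B \<omega> \<epsilon> A *v v) - v \<bullet> (split_C \<omega> \<epsilon> A *v v)"
proof -
  let ?L = "strict_lower_part A" and ?D = "diag_part A"
  have "v \<bullet> (transpose ?L *v v) = v \<bullet> (?L *v v)"
    by (simp only: inner_transpose_mult inner_commute)
  then have "v \<bullet> (split_B \<omega> \<epsilon> A *v v) - v \<bullet> (split_C \<omega> \<epsilon> A *v v)
      = 1 / \<omega> * (v \<bullet> (?D *v v)) - (\<omega> - 1) / \<omega> * (v \<bullet> (?D *v v)) + 2 * \<epsilon> * (norm v)\<^sup>2"
    by (simp add: split_B_def split_C_def matrix_vector_mult_add_rdistrib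
        matrix_vector_mult_diff_rdistrib scaleR_matrix_vector_assoc[symmetric] inner_add_right
        inner_diff_right power2_norm_eq_inner)
  also have "\<dots> = (2 - \<omega>) / \<omega> * (v \<bullet> (?D *v v)) + 2 * \<epsilon> * (norm v)\<^sup>2"
    using omega by (simp add: field_simps)
  finally have "v \<bullet> (split_B \<omega> \<epsilon> A *v v) - v \<bullet> (split_C \<omega> \<epsilon> A *v v)
      = (2 - \<omega>) / \<omega> * (v \<bullet> (?D *v v)) + 2 * \<epsilon> * (norm v)\<^sup>2" .
  moreover have "(2 - \<omega>) / \<omega> * (min_entry (diag_vec (diag_part A)) * (norm v)\<^sup>2)
      \<le> (2 - \<omega>) / \<omega> * (v \<bullet> (diag_part A *v v))"
    using omega by (intro mult_left_mono inner_diag_part_ge) auto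
  ultimately show ?thesis by (simp add: delta algebra_simps)
qed

lemma split_B_mult_plus_split_C_mult:
  fixes A :: "real ^ 'n::{finite,linorder} ^ 'n::{finite,linorder}"
  assumes "pos_semidef A" and "0 < \<omega>"
  shows "split_B \<omega> \<epsilon> A *v v + split_C \<omega> \<epsilon> A *v v = A *v v"
  using split_B_plus_split_C[of A \<omega> \<epsilon>] assms
  by (simp add: pos_semidef_def flip: matrix_vector_mult_add_rdistrib)

lemma split_B_positive:
  fixes A :: "real ^ 'n::{finite,linorder} ^ 'n::{finite,linorder}"
  assumes psd: "pos_semidef A" and omega: "0 < \<omega>" "\<omega> < 2"
    and delta: "\<delta> = 2 * \<epsilon> + (2 - \<omega>) / \<omega> * min_entry (diag_vec (diag_part A))"
  shows "\<delta> / 2 * (norm v)\<^sup>2 \<le> v \<bullet> (split_B \<omega> \<epsilon> A *v v)"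
proof -
  have "v \<bullet> (split_B \<omega> \<epsilon> A *v v) + v \<bullet> (split_C \<omega> \<epsilon> A *v v) = v \<bullet> (A *v v)"
    using split_B_mult_plus_split_C_mult[OF psd omega(1), of \<epsilon> v]
    by (simp flip: inner_add_right)
  moreover have "0 \<le> v \<bullet> (A *v v)" using psd by (simp add: pos_semidef_def)
  ultimately show ?thesis using split_quadratic_forms_gap[OF omega delta, of v] by simp
qed

section \<open>Solvability of the splitting inclusion\<close>

text \<open>
  Row \<open>i\<close> of the inclusion involves only the coordinates \<open>j \<le> i\<close> of the unknown, so the coordinates
  can be chosen one after the other along the order of the index type.
\<close>

lemma ex_splitting_inclusion:
  fixes A :: "real ^ 'n::{finite,linorder} ^ 'n::{finite,linorder}"
  assumes conv: "convex_on UNIV h" and sep: "\<And>v. h v = (\<Sum>i\<in>UNIV. hc i (v $ i))"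
    and diag: "\<And>i. 0 < split_B \<omega> \<epsilon> A $ i $ i"
  shows "\<exists>z. - (split_B \<omega> \<epsilon> A *v z + d) \<in> subdifferential h z"
proof -
  let ?B = "split_B \<omega> \<epsilon> A"
  define P where "P z i t \<longleftrightarrow>
    - (?B $ i $ i * t + ((\<Sum>j | j < i. ?B $ i $ j * z j) + d $ i)) \<in> subdifferential (hc i) t"
    for z :: "'n \<Rightarrow> real" and i t
  have "\<exists>z. \<forall>i. P z i (z i)"
  proof (rule dependent_wf_choice)
    show "wf {(i, j :: 'n). i < j}"
      by (rule wf_subset[OF wf_measure[of "\<lambda>i. card {..<i}"]])
        (auto intro!: psubset_card_mono)
  next
    fix z z' :: "'n \<Rightarrow> real" and i t
    assume "\<And>j. (j, i) \<in> {(i, j). i < j} \<Longrightarrow> z j = z' j"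
    then have "(\<Sum>j | j < i. ?B $ i $ j * z j) = (\<Sum>j | j < i. ?B $ i $ j * z' j)"
      by (intro sum.cong) auto
    then show "P z i t = P z' i t" by (simp add: P_def)
  next
    fix z :: "'n \<Rightarrow> real" and i
    show "\<exists>t. P z i t"
      unfolding P_def
      by (intro ex_scalar_inclusion convex_summand_of_separable[where hc = hc, OF conv sep] diag)
  qed
  then obtain z where z: "\<And>i. P z i (z i)" by blast
  have row: "(?B *v vec_lambda z) $ i = ?B $ i $ i * z i + (\<Sum>j | j < i. ?B $ i $ j * z j)" for i
  proof -
    have zero: "?B $ i $ j = 0" if "i < j" for j
      using that by (auto simp: split_B_def strict_lower_part_def diag_part_def mat_def)
    have "(?B *v vec_lambda z) $ i = (\<Sum>j\<in>UNIV. ?B $ i $ j * z j)"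
      by (simp add: matrix_vector_mult_def)
    also have "\<dots> = (\<Sum>j\<in>insert i {j. j < i}. ?B $ i $ j * z j)"
      by (rule sum.mono_neutral_right) (auto simp: zero not_less)
    finally show ?thesis by simp
  qed
  have "- (?B *v vec_lambda z + d) \<in> subdifferential h (vec_lambda z)"
    using z
    by (intro subdifferential_separableI[where hc = hc, OF sep]) (simp add: P_def row algebra_simps)
  then show ?thesis by blast
qed

lemma zero_in_translate_iff:
  fixes u :: "'a::ab_group_add"
  shows "0 \<in> (\<lambda>g. u + g) ` S \<longleftrightarrow> - u \<in> S"
proof -
  have "0 = u + g \<longleftrightarrow> g = - u" for g
    by (metis add.commute eq_neg_iff_add_eq_0)
  then show ?thesis by (simp add: image_iff)
qed

text \<open>
  If \<open>u\<close> and \<open>v\<close> both solve the inclusion, the difference of their subgradients is \<open>- B (u - v)\<close>;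
  monotonicity and the positivity of \<open>B\<close> then give \<open>u = v\<close>. Uniqueness turns the definite
  description in \<open>splitting_op\<close> into a solution.
\<close>

lemma splitting_op_inclusion:
  fixes A :: "real ^ 'n::{finite,linorder} ^ 'n::{finite,linorder}"
  assumes psd: "pos_semidef A" and conv: "convex_on UNIV h"
    and sep: "\<And>v. h v = (\<Sum>i\<in>UNIV. hc i (v $ i))"
    and omega: "0 < \<omega>" "\<omega> < 2"
    and diag: "\<And>i. 0 < split_B \<omega> \<epsilon> A $ i $ i"
    and delta: "\<delta> = 2 * \<epsilon> + (2 - \<omega>) / \<omega> * min_entry (diag_vec (diag_part A))"
    and delta_pos: "0 < \<delta>"
    and z: "z = splitting_op \<omega> \<epsilon> A b h x"
  shows "- (split_B \<omega> \<epsilon> A *v z + split_C \<omega> \<epsilon> A *v x + b) \<in> subdifferential h z"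
proof -
  define Q where "Q z \<longleftrightarrow> - (split_B \<omega> \<epsilon> A *v z + split_C \<omega> \<epsilon> A *v x + b) \<in> subdifferential h z"
    for z
  have Q_alt: "0 \<in> (\<lambda>g. split_B \<omega> \<epsilon> A *v z + split_C \<omega> \<epsilon> A *v x + b + g) ` subdifferential h z
      \<longleftrightarrow> Q z" for z
    by (simp only: Q_def zero_in_translate_iff)
  have unique: "u = v" if "Q u" "Q v" for u v
  proof -
    have "0 \<le> - ((u - v) \<bullet> (split_B \<omega> \<epsilon> A *v (u - v)))"
      using subdifferential_monotone[OF that[unfolded Q_def]]
      by (simp add: algebra_simps inner_commute matrix_vector_mult_diff_distrib)
    then have "\<delta> / 2 * (norm (u - v))\<^sup>2 \<le> 0"
      using split_B_positive[OF psd omega delta, of "u - v"] by linarith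
    then show ?thesis using delta_pos by (simp add: mult_le_0_iff)
  qed
  have "\<exists>!z. Q z"
    using ex_splitting_inclusion[where hc = hc, OF conv sep diag, of "split_C \<omega> \<epsilon> A *v x + b"]
      unique
    unfolding Q_def by (auto simp: add.assoc)
  then have "Q z"
    unfolding z splitting_op_def Q_alt by (rule theI')
  then show ?thesis by (simp only: Q_def)
qed

section \<open>One step of the splitting\<close>

lemma quad_fun_expansion:
  fixes A :: "real ^ 'n ^ 'n"
  assumes sym: "transpose A = A"
  shows "quad_fun A b y
    = quad_fun A b z + (A *v z + b) \<bullet> (y - z) + 1/2 * ((y - z) \<bullet> (A *v (y - z)))"
proof -
  have "z \<bullet> (A *v y) = y \<bullet> (A *v z)"
    using inner_transpose_mult[of z A y] by (simp add: sym inner_commute)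
  then show ?thesis
    by (simp add: quad_fun_def matrix_vector_mult_diff_distrib inner_add_left inner_add_right
        inner_diff_right inner_diff_left inner_commute add_divide_distrib diff_divide_distrib)
qed

text \<open>
  The subgradient inequality of \<open>h\<close> at \<open>z\<close> added to the expansion of \<open>q\<close> around \<open>z\<close>, where
  \<open>A z + b + g\<close> collapses to \<open>C (z - x)\<close> because \<open>A = B + C\<close>.
\<close>

lemma splitting_step_lower_bound:
  fixes A :: "real ^ 'n::{finite,linorder} ^ 'n::{finite,linorder}"
  assumes psd: "pos_semidef A" and omega: "0 < \<omega>"
    and f: "\<And>v. f v = quad_fun A b v + h v"
    and incl: "- (split_B \<omega> \<epsilon> A *v z + split_C \<omega> \<epsilon> A *v x + b) \<in> subdifferential h z"
  shows "f z + (split_C \<omega> \<epsilon> A *v (z - x)) \<bullet> (y - z) + 1/2 * ((y - z) \<bullet> (A *v (y - z))) \<le> f y"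
proof -
  have "h z + - (split_B \<omega> \<epsilon> A *v z + split_C \<omega> \<epsilon> A *v x + b) \<bullet> (y - z) \<le> h y"
    using incl by (simp add: subdifferential_def)
  moreover have "A *v z + b - (split_B \<omega> \<epsilon> A *v z + split_C \<omega> \<epsilon> A *v x + b)
      = split_C \<omega> \<epsilon> A *v (z - x)"
    using split_B_mult_plus_split_C_mult[OF psd omega, of \<epsilon> z]
    by (simp add: matrix_vector_mult_diff_distrib algebra_simps)
  then have "(A *v z + b) \<bullet> (y - z)
        + - (split_B \<omega> \<epsilon> A *v z + split_C \<omega> \<epsilon> A *v x + b) \<bullet> (y - z)
      = (split_C \<omega> \<epsilon> A *v (z - x)) \<bullet> (y - z)"
    by (metis diff_conv_add_uminus inner_add_left)
  ultimately show ?thesis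
    using quad_fun_expansion[of A b y z] psd by (simp add: f pos_semidef_def)
qed

text \<open>
  For \<open>y = x\<close> the two quadratic terms of the lower bound combine to the form of
  \<open>1/2 A - C = 1/2 (B - C)\<close>.
\<close>

lemma splitting_step_decrease:
  fixes A :: "real ^ 'n::{finite,linorder} ^ 'n::{finite,linorder}"
  assumes psd: "pos_semidef A" and omega: "0 < \<omega>" "\<omega> < 2"
    and delta: "\<delta> = 2 * \<epsilon> + (2 - \<omega>) / \<omega> * min_entry (diag_vec (diag_part A))"
    and f: "\<And>v. f v = quad_fun A b v + h v"
    and incl: "- (split_B \<omega> \<epsilon> A *v z + split_C \<omega> \<epsilon> A *v x + b) \<in> subdifferential h z"
  shows "\<delta> / 2 * (norm (x - z))\<^sup>2 \<le> f x - f z"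
proof -
  let ?v = "x - z"
  have "(split_C \<omega> \<epsilon> A *v (z - x)) \<bullet> ?v = - (?v \<bullet> (split_C \<omega> \<epsilon> A *v ?v))"
    by (simp add: algebra_simps inner_commute matrix_vector_mult_diff_distrib)
  moreover have "?v \<bullet> (split_B \<omega> \<epsilon> A *v ?v) + ?v \<bullet> (split_C \<omega> \<epsilon> A *v ?v) = ?v \<bullet> (A *v ?v)"
    using split_B_mult_plus_split_C_mult[OF psd omega(1), of \<epsilon> ?v]
    by (simp flip: inner_add_right)
  ultimately show ?thesis
    using splitting_step_lower_bound[OF psd omega(1) f incl, of x]
      split_quadratic_forms_gap[OF omega delta, of ?v] by simp
qed

lemma norm_mult_le_spectral_norm: "norm (M *v v) \<le> spectral_norm M * norm v"
  unfolding spectral_norm_def by (intro onorm matrix_vector_mul_bounded_linear)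

lemma spectral_norm_nonneg: "0 \<le> spectral_norm M"
  unfolding spectral_norm_def by (intro onorm_pos_le matrix_vector_mul_bounded_linear)

lemma loewner_le_scaled_identityD:
  assumes "loewner_le (\<sigma> *\<^sub>R mat 1) A"
  shows "\<sigma> * (norm v)\<^sup>2 \<le> v \<bullet> (A *v v)"
proof -
  have "0 \<le> v \<bullet> ((A - \<sigma> *\<^sub>R mat 1) *v v)"
    using assms by (simp add: loewner_le_def pos_semidef_def)
  then show ?thesis
    by (simp add: matrix_vector_mult_diff_rdistrib scaleR_matrix_vector_assoc[symmetric]
        inner_diff_right power2_norm_eq_inner)
qed

text \<open>
  The term \<open>- \<sigma>/2 \<parallel>z - y\<parallel>\<^sup>2\<close> serves twice when \<open>y\<close> is a minimizer: it caps the right-hand side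
  independently of the distance \<open>\<parallel>z - y\<parallel>\<close>, and it caps that distance since the left-hand side is
  then nonnegative.
\<close>

lemma splitting_step_gap:
  fixes A :: "real ^ 'n::{finite,linorder} ^ 'n::{finite,linorder}"
  assumes psd: "pos_semidef A" and omega: "0 < \<omega>"
    and strong: "loewner_le (\<sigma> *\<^sub>R mat 1) A"
    and f: "\<And>v. f v = quad_fun A b v + h v"
    and incl: "- (split_B \<omega> \<epsilon> A *v z + split_C \<omega> \<epsilon> A *v x + b) \<in> subdifferential h z"
  shows "f z - f y \<le> spectral_norm (split_C \<omega> \<epsilon> A) * norm (x - z) * norm (z - y)
    - \<sigma> / 2 * (norm (z - y))\<^sup>2"
proof -
  have "- ((split_C \<omega> \<epsilon> A *v (z - x)) \<bullet> (y - z))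
      \<le> norm (split_C \<omega> \<epsilon> A *v (z - x)) * norm (y - z)"
    using Cauchy_Schwarz_ineq2[of "split_C \<omega> \<epsilon> A *v (z - x)" "y - z"] by linarith
  also have "\<dots> \<le> spectral_norm (split_C \<omega> \<epsilon> A) * norm (z - x) * norm (y - z)"
    by (intro mult_right_mono norm_mult_le_spectral_norm) auto
  finally show ?thesis
    using splitting_step_lower_bound[OF psd omega f incl, of y]
      loewner_le_scaled_identityD[OF strong, of "y - z"]
    by (simp add: norm_minus_commute)
qed

section \<open>Linear convergence\<close>

theorem theorem4:
  fixes A C :: "real ^ 'n::{finite,linorder} ^ 'n::{finite,linorder}"
    and b xstar :: "real ^ 'n::{finite,linorder}"
    and h f :: "real ^ 'n::{finite,linorder} \<Rightarrow> real"
    and hc :: "'n \<Rightarrow> real \<Rightarrow> real"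
    and x :: "nat \<Rightarrow> real ^ 'n::{finite,linorder}"
    and \<omega> \<epsilon> \<delta> \<sigma> R C5 :: real
  assumes A_psd: "pos_semidef A"
    and h_convex: "convex_on UNIV h"
    and h_separable: "\<And>v. h v = (\<Sum>i\<in>UNIV. hc i (v $ i))"
    and f_eq: "\<And>v. f v = quad_fun A b v + h v"
    and f_bounded_below: "bdd_below (range f)"
    and omega: "0 < \<omega>" "\<omega> < 2"
    and epsilon: "0 \<le> \<epsilon>"
    and B_diag_pos: "\<And>i. 0 < split_B \<omega> \<epsilon> A $ i $ i"
    and C_eq: "C = split_C \<omega> \<epsilon> A"
    and delta_eq: "\<delta> = 2 * \<epsilon> + (2 - \<omega>) / \<omega> * min_entry (diag_vec (diag_part A))"
    and delta_pos: "0 < \<delta>"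
    and sigma_pos: "0 < \<sigma>"
    and q_strongly_convex: "loewner_le (\<sigma> *\<^sub>R mat 1) A"
    and iter: "\<And>k. x (Suc k) = splitting_op \<omega> \<epsilon> A b h (x k)"
    and x_bounded: "\<And>k. norm (x k) \<le> R"
    and xstar_min: "is_arg_min f (\<lambda>_. True) xstar"
    and C5_eq: "C5 = (spectral_norm C)\<^sup>2 / (\<delta> * \<sigma>)"
  shows "\<forall>k. f (x k) - f xstar \<le> (C5 / (1 + C5)) ^ k * (f (x 0) - f xstar)
    \<and> (norm (x (Suc k) - xstar))\<^sup>2
        \<le> 8 * (spectral_norm C)\<^sup>2 / (\<sigma>\<^sup>2 * \<delta>) * (C5 / (1 + C5)) ^ k * (f (x 0) - f xstar)"
proof -
  let ?c = "spectral_norm C"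
  let ?rate = "C5 / (1 + C5)"
  define gap where "gap k = f (x k) - f xstar" for k
  have gap_nonneg: "0 \<le> gap k" for k
    using xstar_min by (auto simp: gap_def is_arg_min_linorder)
  have C5_nonneg: "0 \<le> C5"
    using delta_pos sigma_pos by (simp add: C5_eq)
  have incl: "- (split_B \<omega> \<epsilon> A *v x (Suc k) + split_C \<omega> \<epsilon> A *v x k + b)
      \<in> subdifferential h (x (Suc k))" for k
    using splitting_op_inclusion[where hc = hc, OF A_psd h_convex h_separable omega B_diag_pos delta_eq delta_pos]
      iter .
  define d where "d k = norm (x k - x (Suc k))" for k
  define e where "e k = norm (x (Suc k) - xstar)" for k
  have decrease: "(d k)\<^sup>2 \<le> 2 / \<delta> * (gap k - gap (Suc k))" for k
    using splitting_step_decrease[OF A_psd omega delta_eq f_eq incl[of k]] delta_pos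
    by (simp add: gap_def d_def field_simps)
  have upper: "gap (Suc k) \<le> ?c * d k * e k - \<sigma> / 2 * (e k)\<^sup>2" for k
    using splitting_step_gap[OF A_psd omega(1) q_strongly_convex f_eq incl[of k], of xstar]
    by (simp add: gap_def d_def e_def C_eq)
  have contraction: "gap (Suc k) \<le> ?rate * gap k" for k
  proof -
    \<comment> \<open>Completing the square in \<open>e k\<close> removes the unknown distance from the upper bound.\<close>
    have "0 \<le> (?c * d k - \<sigma> * e k)\<^sup>2 / (2 * \<sigma>)"
      using sigma_pos by simp
    also have "\<dots> = ?c\<^sup>2 / (2 * \<sigma>) * (d k)\<^sup>2 - (?c * d k * e k - \<sigma> / 2 * (e k)\<^sup>2)"
      using sigma_pos by (simp add: field_simps power2_eq_square)
    finally have "gap (Suc k) \<le> ?c\<^sup>2 / (2 * \<sigma>) * (d k)\<^sup>2"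
      using upper[of k] by simp
    also have "\<dots> \<le> ?c\<^sup>2 / (2 * \<sigma>) * (2 / \<delta> * (gap k - gap (Suc k)))"
      using sigma_pos by (intro mult_left_mono decrease) auto
    also have "\<dots> = C5 * (gap k - gap (Suc k))"
      using sigma_pos delta_pos by (simp add: C5_eq field_simps)
    finally show ?thesis
      using C5_nonneg by (simp add: field_simps)
  qed
  have rate: "gap k \<le> ?rate ^ k * gap 0" for k
  proof (induction k)
    case (Suc k)
    have "gap (Suc k) \<le> ?rate * gap k" by (rule contraction)
    also have "\<dots> \<le> ?rate * (?rate ^ k * gap 0)"
      using C5_nonneg by (intro mult_left_mono Suc) auto
    finally show ?case by simp
  qed simp
  have distance: "(e k)\<^sup>2 \<le> 8 * ?c\<^sup>2 / (\<sigma>\<^sup>2 * \<delta>) * gap k" for k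
  proof -
    have "\<sigma> / 2 * e k * e k \<le> ?c * d k * e k"
      using upper[of k] gap_nonneg[of "Suc k"] by (simp add: power2_eq_square)
    \<comment> \<open>Cancel \<open>e k\<close>, unless the iterate has reached the minimizer and \<open>e k = 0\<close>.\<close>
    then have "e k \<le> 2 * ?c / \<sigma> * d k"
      using sigma_pos spectral_norm_nonneg[of C]
      by (cases "e k = 0") (auto simp: e_def d_def field_simps)
    then have "(e k)\<^sup>2 \<le> (2 * ?c / \<sigma> * d k)\<^sup>2"
      by (intro power_mono) (auto simp: e_def)
    also have "\<dots> = 4 * ?c\<^sup>2 / \<sigma>\<^sup>2 * (d k)\<^sup>2"
      by (simp add: power_mult_distrib power_divide)
    also have "\<dots> \<le> 4 * ?c\<^sup>2 / \<sigma>\<^sup>2 * (2 / \<delta> * (gap k - gap (Suc k)))"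
      by (intro mult_left_mono decrease) auto
    also have "\<dots> \<le> 4 * ?c\<^sup>2 / \<sigma>\<^sup>2 * (2 / \<delta> * gap k)"
      using delta_pos gap_nonneg[of "Suc k"] by (intro mult_left_mono) auto
    finally show ?thesis by (simp add: field_simps)
  qed
  have "(e k)\<^sup>2 \<le> 8 * ?c\<^sup>2 / (\<sigma>\<^sup>2 * \<delta>) * ?rate ^ k * gap 0" for k
  proof -
    have "8 * ?c\<^sup>2 / (\<sigma>\<^sup>2 * \<delta>) * gap k \<le> 8 * ?c\<^sup>2 / (\<sigma>\<^sup>2 * \<delta>) * (?rate ^ k * gap 0)"
      using delta_pos by (intro mult_left_mono rate) auto
    then show ?thesis using distance[of k] by (simp add: mult.assoc)
  qed
  with rate show ?thesis by (simp add: gap_def e_def)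
qed

end
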